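(* Let $r\ge1$, $\delta\ge3$, $m\ge2$ be integers, let $n_L=r+\delta-1$, let $n\ge mn_L$, and let $q$ be a prime power with $q>\binom{n}{mr}$. Suppose there exists an $((n_L,r,d),(\alpha,\beta))$ exact-repair MSR code over $\mathbb{F}_q$. Then there exists an MSR-local code over $\mathbb{F}_q$ with $(r,\delta)$ information locality, of length $n$, vector-size parameter $\alpha$ and scalar dimension $K=mr\alpha$, whose minimum distance is $$d_{\min}=n-\frac{K}{\alpha}+1-\left(\frac{K}{r\alpha}-1\right)(\delta-1).$$
   Context: Vector codes. An $\mathbb{F}_q$-linear vector code $\mathcal{C}$ of block length $n$ with vector-size parameter $\alpha$ is an $\mathbb{F}_q$-linear subspace of $(\mathbb{F}_q^\alpha)^n$; its scalar dimension is $K=\dim_{\mathbb{F}_q}\mathcal{C}$. Its generator matrix $G$ is a $K\times n\alpha$ generator matrix of the scalar code obtained by expanding each vector symbol; columns $(i-1)\alpha+1,\dots,i\alpha$ form the $i$-th thick column, associated with the $i$-th vector symbol. Standing assumption: the $\alpha$ columns in each thick column are linearly independent. For $S\subseteq[n]$, $G|_S$ is the restriction to thick columns in $S$, and $\mathcal{C}|_S$ the punctured code (restriction of codewords to $S$). $d_{\min}$ is the minimum Hamming weight, counted in vector symbols, of a nonzero codeword. MSR codes. A linear exact-repair $((n,k,d),(\alpha,\beta),B)$ regenerating code over $\mathbb{F}_q$ ($k\le d\le n-1$) is a vector code of block length $n$, vector-size parameter $\alpha$ and scalar dimension $B$ such that (i) every codeword is determined by any $k$ of its vector symbols; (ii)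 for every $i\in[n]$ and every set $D\subseteq[n]\setminus\{i\}$ with $|D|=d$ there are $\mathbb{F}_q$-linear maps $\varphi_h:\mathbb{F}_q^\alpha\to\mathbb{F}_q^\beta$, $h\in D$, such that for every codeword $\mathbf{c}$ the symbol $\mathbf{c}_i$ is determined by $(\varphi_h(\mathbf{c}_h))_{h\in D}$. It is an MSR code if $B=k\alpha$ and $\alpha=(d-k+1)\beta$. An MSR code with parameters $(n,k,d)$ is called an $(n,k,d)$-MSR code. Locality. $\mathcal{C}$ has $(r,\delta)$ information locality if there are sets $S_i\subseteq[n]$, $i\in\mathcal{L}$, with $|S_i|\le r+\delta-1$, $d_{\min}(\mathcal{C}|_{S_i})\ge\delta$, and $\mathrm{Rank}(G|_{\cup_iS_i})=K$; the $\mathcal{C}|_{S_i}$ are the local codes. $\mathcal{C}$ (with $(r,\delta)$ information locality) is an MSR-local code with $(r,\delta)$ information locality if it can be punctured to yield $m$ local codes $\mathcal{C}_i=\mathcal{C}|_{S_i}$, each an $(n_L,r,d)$-MSR code with $n_L=r+\delta-1$, such that $\mathrm{Rank}(G|_{\cup_{i=1}^mS_i})=K$. *)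

theory Defs
  imports Complex_Main "HOL-Library.Function_Algebras" "HOL-Library.Cardinality"
begin

(* Coordinate vectors over a field are functions 'b => 'a vanishing outside the
   relevant finite coordinate set. *)

definition fscale :: "'a::field \<Rightarrow> ('b \<Rightarrow> 'a) \<Rightarrow> 'b \<Rightarrow> 'a" where
  "fscale a f = (\<lambda>x. a * f x)"

global_interpretation fs: vector_space "fscale :: 'a::field \<Rightarrow> ('b \<Rightarrow> 'a) \<Rightarrow> 'b \<Rightarrow> 'a"
  by unfold_locales (auto simp: fscale_def plus_fun_def algebra_simps)

definition coord_space :: "nat \<Rightarrow> (nat \<Rightarrow> 'a::field) set" where
  "coord_space s = {v. \<forall>j. j \<ge> s \<longrightarrow> v j = 0}"

(* A word c of (F^alpha)^I is stored in expanded form: c (i, j) is scalar number j < alpha of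
   the vector symbol at position i, and curry c i is that symbol.  Positions range over a finite
   set I rather than over an initial segment, so that a punctured code keeps the positions of
   the code it comes from; the block length is card I. *)

type_synonym 'a word = "nat \<times> nat \<Rightarrow> 'a"

definition word_space :: "nat set \<Rightarrow> nat \<Rightarrow> 'a::field word set" where
  "word_space I \<alpha> = {c. \<forall>x. x \<notin> I \<times> {..<\<alpha>} \<longrightarrow> c x = 0}"

(* G t, for t < K = dim C, is row t of a generator matrix; the rows form a basis of C. *)
definition generator_matrix :: "'a::field word set \<Rightarrow> (nat \<Rightarrow> 'a word) \<Rightarrow> bool" where
  "generator_matrix C G \<longleftrightarrow>
     inj_on G {..<fs.dim C} \<and> fs.independent (G ` {..<fs.dim C}) \<and> fs.span (G ` {..<fs.dim C}) = C"

definition gcolumn :: "nat \<Rightarrow> (nat \<Rightarrow> 'a::field word) \<Rightarrow> nat \<times> nat \<Rightarrow> nat \<Rightarrow> 'a" where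
  "gcolumn K G x = (\<lambda>t. if t < K then G t x else 0)"

(* Column rank of the restriction of a K-row matrix G to the thick columns in S. *)
definition thick_rank :: "nat \<Rightarrow> nat \<Rightarrow> (nat \<Rightarrow> 'a::field word) \<Rightarrow> nat set \<Rightarrow> nat" where
  "thick_rank K \<alpha> G S = fs.dim (gcolumn K G ` (S \<times> {..<\<alpha>}))"

(* Linear independence of the columns as a family: they are pairwise distinct and form an
   independent set. *)
definition thick_column_independent :: "nat \<Rightarrow> nat \<Rightarrow> (nat \<Rightarrow> 'a::field word) \<Rightarrow> nat \<Rightarrow> bool" where
  "thick_column_independent K \<alpha> G i \<longleftrightarrow>
     inj_on (gcolumn K G) ({i} \<times> {..<\<alpha>}) \<and> fs.independent (gcolumn K G ` ({i} \<times> {..<\<alpha>}))"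

(* Row operations preserve column relations, so the quantifier over G here and in the two
   locality definitions below may equally be read as universal. *)
definition vector_code :: "nat set \<Rightarrow> nat \<Rightarrow> 'a::field word set \<Rightarrow> bool" where
  "vector_code I \<alpha> C \<longleftrightarrow>
     finite I \<and> \<alpha> \<ge> 1 \<and> fs.subspace C \<and> C \<subseteq> word_space I \<alpha> \<and>
     (\<exists>G. generator_matrix C G \<and> (\<forall>i\<in>I. thick_column_independent (fs.dim C) \<alpha> G i))"

definition puncture :: "nat set \<Rightarrow> 'a::field word set \<Rightarrow> 'a word set" where
  "puncture S C = (\<lambda>c (i, j). if i \<in> S then c (i, j) else 0) ` C"

definition weight :: "'a::field word \<Rightarrow> nat" where
  "weight c = card {i. curry c i \<noteq> 0}"

(* The infimum is a minimum unless C = {0}, where it takes the dummy value 0. *)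
definition min_dist :: "'a::field word set \<Rightarrow> nat" where
  "min_dist C = (INF c\<in>C - {0}. weight c)"

(* Linear maps from F^alpha to F^beta are given by linear maps of the ambient function space
   that send F^alpha into F^beta; only their values on F^alpha are used. *)
definition repairable :: "'a::field word set \<Rightarrow> nat \<Rightarrow> nat \<Rightarrow> nat set \<Rightarrow> nat \<Rightarrow> bool" where
  "repairable C \<alpha> \<beta> D i \<longleftrightarrow>
     (\<exists>\<phi> :: nat \<Rightarrow> (nat \<Rightarrow> 'a) \<Rightarrow> nat \<Rightarrow> 'a.
        (\<forall>h\<in>D. Vector_Spaces.linear fscale fscale (\<phi> h) \<and>
                \<phi> h ` coord_space \<alpha> \<subseteq> coord_space \<beta>) \<and>
        (\<forall>c\<in>C. \<forall>c'\<in>C. (\<forall>h\<in>D. \<phi> h (curry c h) = \<phi> h (curry c' h)) \<longrightarrow> curry c i = curry c' i))"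

definition regenerating_code ::
  "nat set \<Rightarrow> nat \<Rightarrow> nat \<Rightarrow> nat \<Rightarrow> nat \<Rightarrow> nat \<Rightarrow> 'a::field word set \<Rightarrow> bool" where
  "regenerating_code I k d \<alpha> \<beta> B C \<longleftrightarrow>
     vector_code I \<alpha> C \<and> fs.dim C = B \<and> k \<le> d \<and> d < card I \<and>
     (\<forall>S\<subseteq>I. card S = k \<longrightarrow>
        (\<forall>c\<in>C. \<forall>c'\<in>C. (\<forall>h\<in>S. curry c h = curry c' h) \<longrightarrow> c = c')) \<and>
     (\<forall>i\<in>I. \<forall>D\<subseteq>I - {i}. card D = d \<longrightarrow> repairable C \<alpha> \<beta> D i)"

definition msr_code ::
  "nat set \<Rightarrow> nat \<Rightarrow> nat \<Rightarrow> nat \<Rightarrow> nat \<Rightarrow> 'a::field word set \<Rightarrow> bool" where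
  "msr_code I k d \<alpha> \<beta> C \<longleftrightarrow>
     regenerating_code I k d \<alpha> \<beta> (k * \<alpha>) C \<and> \<alpha> = (d - k + 1) * \<beta>"

definition local_code :: "nat set \<Rightarrow> nat \<Rightarrow> nat \<Rightarrow> 'a::field word set \<Rightarrow> nat set \<Rightarrow> bool" where
  "local_code I r \<delta> C S \<longleftrightarrow>
     S \<subseteq> I \<and> card S \<le> r + \<delta> - 1 \<and> min_dist (puncture S C) \<ge> \<delta>"

definition information_locality ::
  "nat set \<Rightarrow> nat \<Rightarrow> nat \<Rightarrow> nat \<Rightarrow> 'a::field word set \<Rightarrow> bool" where
  "information_locality I \<alpha> r \<delta> C \<longleftrightarrow>
     (\<exists>(L :: nat set) S. (\<forall>i\<in>L. local_code I r \<delta> C (S i)) \<and>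
        (\<exists>G. generator_matrix C G \<and> thick_rank (fs.dim C) \<alpha> G (\<Union>i\<in>L. S i) = fs.dim C))"

definition msr_local_code ::
  "nat set \<Rightarrow> nat \<Rightarrow> nat \<Rightarrow> nat \<Rightarrow> nat \<Rightarrow> nat \<Rightarrow> 'a::field word set \<Rightarrow> bool" where
  "msr_local_code I m r \<delta> d \<alpha> C \<longleftrightarrow>
     vector_code I \<alpha> C \<and> information_locality I \<alpha> r \<delta> C \<and>
     (\<exists>S. (\<forall>i\<in>{1..m}. local_code I r \<delta> C (S i) \<and> card (S i) = r + \<delta> - 1 \<and>
                        (\<exists>\<beta>. msr_code (S i) r d \<alpha> \<beta> (puncture (S i) C))) \<and>
          (\<exists>G. generator_matrix C G \<and>
               thick_rank (fs.dim C) \<alpha> G (\<Union>i\<in>{1..m}. S i) = fs.dim C))"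

end

(* Take m independent copies of the MSR code and append the remaining symbols as scalar linear
   functionals of the resulting words.  Call a set T of m r positions good if it meets every local
   block in at most r positions.  If every good T is an information set, then the code has the
   required distance: a set of m r + (m - 1) (delta - 1) positions always contains a good one, so no
   nonzero word vanishes on it, whereas some nonzero word vanishes on m - 1 blocks and r - 1
   positions of the last block.  The local symbols of a good T leave a space of undetermined words of
   dimension at most the number of parity scalars in T.  The functionals are chosen one by one; each
   has to be nonzero on the space still left for each good T, i.e. to avoid at most binom(n, m r) < q
   hyperplanes, which is possible over a field with q elements. *)
theory Submission
  imports Defs "HOL-Library.FuncSet" "HOL-Library.Disjoint_Sets"
begin

section \<open>Sizes of subspaces over a finite field\<close>

lemma finite_span_independent:
  fixes B :: "('b \<Rightarrow> 'a::{field,finite}) set"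
  assumes "finite B" "fs.independent B"
  shows "finite (fs.span B) \<and> card (fs.span B) = CARD('a) ^ card B"
  using assms
proof (induction B rule: finite_induct)
  case empty
  then show ?case by simp
next
  case (insert b B)
  \<comment> \<open>Adjoining \<open>b\<close> multiplies the span by the field size, because
    \<open>?f\<close> is a bijection from pairs of a coefficient of \<open>b\<close> and a vector of
    the old span.\<close>
  let ?f = "\<lambda>(k, v). fscale k b + v"
  have ind: "fs.independent B" "b \<notin> fs.span B"
    using insert.prems insert.hyps by (auto simp: fs.independent_insert)
  have img: "fs.span (insert b B) = ?f ` (UNIV \<times> fs.span B)"
  proof (intro set_eqI iffI)
    fix x assume "x \<in> fs.span (insert b B)"
    then obtain k where "x - fscale k b \<in> fs.span B"
      by (auto simp: fs.span_insert)
    then show "x \<in> ?f ` (UNIV \<times> fs.span B)"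
      by (intro image_eqI[of _ _ "(k, x - fscale k b)"]) auto
  next
    fix x assume "x \<in> ?f ` (UNIV \<times> fs.span B)"
    then obtain k v where "x = fscale k b + v" "v \<in> fs.span B" by auto
    then show "x \<in> fs.span (insert b B)"
      by (auto simp: fs.span_insert intro!: exI[of _ k])
  qed
  have inj: "inj_on ?f (UNIV \<times> fs.span B)"
  proof (rule inj_onI, clarsimp)
    fix k v k' v'
    assume v: "v \<in> fs.span B" "v' \<in> fs.span B" and eq: "fscale k b + v = fscale k' b + v'"
    have "fscale (k - k') b = v' - v"
      using eq by (simp add: fs.scale_left_diff_distrib algebra_simps)
    then have "fscale (k - k') b \<in> fs.span B"
      using v by (simp add: fs.span_diff)
    then have "k = k'"
      using ind(2) fs.span_scale[of "fscale (k - k') b" B "inverse (k - k')"]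
      by (cases "k = k'") auto
    then show "k = k' \<and> v = v'"
      using eq by simp
  qed
  show ?case
    unfolding img using insert.IH[OF ind(1)] insert.hyps
    by (auto simp: card_image[OF inj] card_cartesian_product)
qed

text \<open>The bridge between dimension and counting: dimensions are compared below by comparing
  powers of the field size.\<close>

lemma card_subspace:
  fixes C :: "('b \<Rightarrow> 'a::{field,finite}) set"
  assumes "finite C" "fs.subspace C"
  shows "card C = CARD('a) ^ fs.dim C"
proof -
  obtain B where B: "B \<subseteq> C" "fs.independent B" "C \<subseteq> fs.span B" "card B = fs.dim C"
    using fs.basis_exists by blast
  have "fs.span B = C"
    using B assms(2) by (meson fs.span_minimal subset_antisym)
  then show ?thesis
    using finite_span_independent[of B] B assms(1) finite_subset by metis
qed

lemma CARD_gt_1: "1 < CARD('a::{field,finite})"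
proof -
  have "card {0, 1 :: 'a} \<le> CARD('a)"
    by (rule card_mono) auto
  then show ?thesis by simp
qed

lemma power_CARD_inject:
  "CARD('a::{field,finite}) ^ i = CARD('a) ^ j \<longleftrightarrow> i = j"
  using CARD_gt_1[where 'a='a] by (simp add: power_inject_exp)

section \<open>Sets of coordinates that determine a word\<close>

text \<open>For a subspace \<open>C\<close> a trivial kernel means that restriction to
  \<open>X\<close> is injective; if moreover \<open>card X = fs.dim C\<close>, then \<open>X\<close>
  is an information set. A set \<open>T\<close> of vector symbols enters as
  \<open>T \<times> {..<\<alpha>}\<close>.\<close>

definition determines :: "'b set \<Rightarrow> ('b \<Rightarrow> 'a::field) set \<Rightarrow> bool" where
  "determines X C \<longleftrightarrow> (\<forall>c\<in>C. (\<forall>x\<in>X. c x = 0) \<longrightarrow> c = 0)"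

text \<open>Two words that agree on \<open>X\<close> differ by a word vanishing on \<open>X\<close>,
  so restriction embeds \<open>C\<close> into the functions on \<open>X\<close>. This also yields
  finiteness of \<open>C\<close>.\<close>

lemma determines_card_le:
  fixes C :: "('b \<Rightarrow> 'a::{field,finite}) set"
  assumes "finite X" "fs.subspace C" "determines X C"
  shows "finite C" "card C \<le> CARD('a) ^ card X"
proof -
  have inj: "inj_on (\<lambda>c. restrict c X) C"
  proof (rule inj_onI)
    fix c c' assume c: "c \<in> C" "c' \<in> C" and eq: "restrict c X = restrict c' X"
    have "c x = c' x" if "x \<in> X" for x
      using fun_cong[OF eq, of x] that by simp
    then have "c - c' = 0"
      using assms(3) fs.subspace_diff[OF assms(2) c] by (auto simp: determines_def)
    then show "c = c'" by simp
  qed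
  have sub: "(\<lambda>c. restrict c X) ` C \<subseteq> (X \<rightarrow>\<^sub>E (UNIV :: 'a set))"
    by auto
  have fin: "finite (X \<rightarrow>\<^sub>E (UNIV :: 'a set))"
    using assms(1) by (simp add: finite_PiE)
  show "finite C"
    using inj sub fin by (rule inj_on_finite)
  show "card C \<le> CARD('a) ^ card X"
    using card_inj_on_le[OF inj sub fin] assms(1) by (simp add: card_PiE)
qed

lemma determines_mono: "determines X C \<Longrightarrow> X \<subseteq> Y \<Longrightarrow> D \<subseteq> C \<Longrightarrow> determines Y D"
  by (auto simp: determines_def subset_iff)

lemma word_space_determined:
  "C \<subseteq> word_space I \<alpha> \<Longrightarrow> determines (I \<times> {..<\<alpha>}) C"
  by (force simp: determines_def word_space_def fun_eq_iff)

section \<open>Generator matrices: independence of columns and column rank\<close>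

lemma generator_matrix_exists:
  assumes "finite C" "fs.subspace C"
  shows "\<exists>G. generator_matrix C G"
proof -
  obtain B where B: "B \<subseteq> C" "fs.independent B" "C \<subseteq> fs.span B" "card B = fs.dim C"
    using fs.basis_exists by blast
  have span: "fs.span B = C"
    using B assms(2) by (meson fs.span_minimal subset_antisym)
  have "finite B"
    using B(1) assms(1) finite_subset by blast
  then obtain G where "bij_betw G {..<fs.dim C} B"
    using ex_bij_betw_nat_finite[of B] B(4) by (auto simp: atLeast0LessThan)
  then show ?thesis
    using B(2) span by (auto simp: generator_matrix_def bij_betw_def)
qed

text \<open>A relation among the columns passes from the rows to all codewords. If it involved
  \<open>x0\<close>, the entry at \<open>x0\<close> would follow from the others, so
  \<open>X - {x0}\<close> would still determine \<open>C\<close>, although it is too small to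
  separate all codewords.\<close>

lemma gcolumns_independent:
  fixes C :: "'a::{field,finite} word set"
  assumes G: "generator_matrix C G" and X: "finite X" "card X = fs.dim C" "determines X C"
    and C: "fs.subspace C"
  shows "inj_on (gcolumn (fs.dim C) G) X" (is "inj_on ?g X")
    and "fs.independent (gcolumn (fs.dim C) G ` X)"
proof -
  \<comment> \<open>Independence is stated for the columns as a family, so that it gives both
    distinctness and independence of the set of columns.\<close>
  have ind: "a x0 = 0" if zero: "\<And>t. (\<Sum>x\<in>X. a x * ?g x t) = 0" and x0: "x0 \<in> X" for a x0
  proof (rule ccontr)
    assume nz: "a x0 \<noteq> 0"
    have ann: "(\<Sum>x\<in>X. a x * c x) = 0" if "c \<in> C" for c
    proof -
      have "c \<in> fs.span (G ` {..<fs.dim C})"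
        using that G by (simp add: generator_matrix_def)
      then show ?thesis
      proof (induction rule: fs.span_induct_alt)
        case base
        then show ?case by simp
      next
        case (step k g c)
        then obtain t where t: "t < fs.dim C" "g = G t" by auto
        have "(\<Sum>x\<in>X. a x * g x) = 0"
          using zero[of t] t by (simp add: gcolumn_def)
        moreover have "(\<Sum>x\<in>X. a x * (fscale k g + c) x)
            = k * (\<Sum>x\<in>X. a x * g x) + (\<Sum>x\<in>X. a x * c x)"
          by (simp add: fscale_def algebra_simps sum.distrib sum_distrib_left)
        ultimately show ?case using step by simp
      qed
    qed
    have "determines (X - {x0}) C"
      unfolding determines_def
    proof (intro ballI impI)
      fix c assume c: "c \<in> C" and z: "\<forall>x\<in>X - {x0}. c x = 0"
      have "(\<Sum>x\<in>X. a x * c x) = a x0 * c x0"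
        using X(1) x0 z by (subst sum.remove[of X x0]) auto
      then have "c x0 = 0"
        using ann[OF c] nz by simp
      then show "c = 0"
        using X(3) c z by (auto simp: determines_def)
    qed
    from determines_card_le[OF _ C this] X(1)
    have "finite C" "card C \<le> CARD('a) ^ card (X - {x0})" by auto
    then have "CARD('a) ^ fs.dim C \<le> CARD('a) ^ (fs.dim C - 1)"
      using card_subspace[OF _ C] X x0 by simp
    then have "fs.dim C \<le> fs.dim C - 1"
      using CARD_gt_1[where 'a='a] by (simp add: power_increasing_iff)
    moreover have "card X > 0"
      using X(1) x0 by (auto simp: card_gt_0_iff)
    ultimately show False using X(2) by simp
  qed
  show inj: "inj_on ?g X"
  proof (rule inj_onI, rule ccontr)
    fix x y assume xy: "x \<in> X" "y \<in> X" "?g x = ?g y" "x \<noteq> y"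
    \<comment> \<open>Two equal columns satisfy the relation with coefficients 1 and -1.\<close>
    let ?a = "\<lambda>z. if z = x then 1 else if z = y then - 1 else (0::'a)"
    have "(\<Sum>z\<in>X. ?a z * ?g z t) = 0" for t
    proof -
      have "(\<Sum>z\<in>X. ?a z * ?g z t)
          = (\<Sum>z\<in>X. (if z = x then ?g z t else 0) - (if z = y then ?g z t else 0))"
        using xy(4) by (intro sum.cong) auto
      also have "\<dots> = 0"
        using xy X(1) by (simp add: sum_subtractf)
      finally show ?thesis .
    qed
    from ind[OF this xy(1)] show False by simp
  qed
  show "fs.independent (?g ` X)"
  proof
    assume "fs.dependent (?g ` X)"
    then obtain u v where uv: "v \<in> ?g ` X" "u v \<noteq> 0" "(\<Sum>v\<in>?g ` X. fscale (u v) v) = 0"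
      using fs.dependent_finite[of "?g ` X"] X(1) by auto
    have "(\<Sum>x\<in>X. u (?g x) * ?g x t) = 0" for t
    proof -
      have "(\<Sum>x\<in>X. fscale (u (?g x)) (?g x)) = 0"
        using uv(3) by (simp add: sum.reindex[OF inj])
      then have "(\<Sum>x\<in>X. fscale (u (?g x)) (?g x)) t = 0"
        by simp
      moreover have "(\<Sum>x\<in>X. f x) t = (\<Sum>x\<in>X. f x t)" for f :: "_ \<Rightarrow> nat \<Rightarrow> 'a"
        using X(1) by (induction X rule: finite_induct) auto
      ultimately show ?thesis by (simp add: fscale_def)
    qed
    from ind[OF this] uv(1,2) show False by auto
  qed
qed

text \<open>The columns at the information set \<open>T\<close> are independent and as many as there
  are rows, so they already span the whole column space and the other columns of \<open>S\<close>
  add nothing.\<close>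

lemma thick_rank_eq_dim:
  fixes C :: "'a::{field,finite} word set"
  assumes G: "generator_matrix C G" and T: "finite T" "card T * \<alpha> = fs.dim C" "T \<subseteq> S"
    "determines (T \<times> {..<\<alpha>}) C" and C: "fs.subspace C"
  shows "thick_rank (fs.dim C) \<alpha> G S = fs.dim C"
proof -
  define K where "K = fs.dim C"
  let ?g = "gcolumn K G" and ?X = "T \<times> {..<\<alpha>}"
  have X: "finite ?X" "card ?X = K"
    using T by (auto simp: card_cartesian_product K_def)
  note ind = gcolumns_independent[OF G X(1) X(2)[unfolded K_def] T(4) C, folded K_def]
  have card_g: "card (?g ` ?X) = K"
    using card_image[OF ind(1)] X(2) by simp
  have subsp: "fs.subspace (coord_space K :: (nat \<Rightarrow> 'a) set)"
    by (auto simp: fs.subspace_def coord_space_def fscale_def)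
  have det: "determines {..<K} (coord_space K :: (nat \<Rightarrow> 'a) set)"
    unfolding determines_def coord_space_def
    by (auto simp: fun_eq_iff) (meson lessThan_iff not_less)
  have g_in: "?g x \<in> coord_space K" for x
    by (simp add: gcolumn_def coord_space_def)
  have "fs.span (?g ` ?X) = coord_space K"
  proof (rule card_seteq)
    show "finite (coord_space K :: (nat \<Rightarrow> 'a) set)"
      using determines_card_le(1)[OF _ subsp det] by simp
    show "fs.span (?g ` ?X) \<subseteq> coord_space K"
      using g_in by (intro fs.span_minimal subsp) auto
    show "card (coord_space K :: (nat \<Rightarrow> 'a) set) \<le> card (fs.span (?g ` ?X))"
      using determines_card_le(2)[OF _ subsp det] finite_span_independent[OF _ ind(2)] X(1) card_g
      by simp
  qed
  moreover have "fs.span (?g ` ?X) \<subseteq> fs.span (?g ` (S \<times> {..<\<alpha>}))"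
    using T(3) by (intro fs.span_mono) auto
  moreover have "fs.span (?g ` (S \<times> {..<\<alpha>})) \<subseteq> coord_space K"
    using g_in by (intro fs.span_minimal subsp) auto
  ultimately have "fs.span (?g ` ?X) = fs.span (?g ` (S \<times> {..<\<alpha>}))"
    by simp
  from fs.dim_eq_card[OF this ind(2)] show ?thesis
    using card_g by (simp add: thick_rank_def K_def)
qed

text \<open>The standing assumption on thick columns holds as soon as every position lies in some
  information set: its columns are then part of an independent family.\<close>

lemma vector_code_if_determined:
  fixes C :: "'a::{field,finite} word set"
  assumes "finite I" "\<alpha> \<ge> 1" "fs.subspace C" "C \<subseteq> word_space I \<alpha>"
    and T: "\<And>i. i \<in> I \<Longrightarrow> \<exists>T. i \<in> T \<and> T \<subseteq> I \<and> card T * \<alpha> = fs.dim C \<and> determines (T \<times> {..<\<alpha>}) C"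
  shows "vector_code I \<alpha> C"
proof -
  have "finite C"
    using determines_card_le(1)[OF _ assms(3) word_space_determined[OF assms(4)]] assms(1) by simp
  then obtain G where G: "generator_matrix C G"
    using generator_matrix_exists assms(3) by blast
  have "thick_column_independent (fs.dim C) \<alpha> G i" if i: "i \<in> I" for i
  proof -
    obtain T where T: "i \<in> T" "T \<subseteq> I" "card T * \<alpha> = fs.dim C" "determines (T \<times> {..<\<alpha>}) C"
      using T[OF i] by blast
    have "finite T" using T(2) assms(1) finite_subset by blast
    then have X: "finite (T \<times> {..<\<alpha>})" "card (T \<times> {..<\<alpha>}) = fs.dim C"
      using T by (auto simp: card_cartesian_product)
    note ind = gcolumns_independent[OF G X T(4) assms(3)]
    have sub: "{i} \<times> {..<\<alpha>} \<subseteq> T \<times> {..<\<alpha>}" using T(1) by auto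
    show ?thesis
      unfolding thick_column_independent_def
      using inj_on_subset[OF ind(1) sub] fs.independent_mono[OF ind(2) image_mono[OF sub]] by simp
  qed
  then show ?thesis
    using assms G by (auto simp: vector_code_def)
qed

section \<open>Linear functionals avoiding few hyperplanes\<close>

text \<open>The coefficient vectors \<open>w\<close> that vanish at \<open>u T\<close> form a
  hyperplane, and fewer hyperplanes than field elements do not cover the space. In the induction a
  line of functionals is searched for a point off all of them.\<close>

lemma ex_functional_nonzero:
  fixes u :: "'t \<Rightarrow> 'b \<Rightarrow> 'a::{field,finite}"
  assumes "finite Y" "finite \<T>" "card \<T> < CARD('a)" "\<And>T. T \<in> \<T> \<Longrightarrow> \<exists>y\<in>Y. u T y \<noteq> 0"
  shows "\<exists>w. \<forall>T\<in>\<T>. (\<Sum>y\<in>Y. w y * u T y) \<noteq> 0"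
  using assms(2-)
proof (induction \<T> rule: finite_induct)
  case empty
  then show ?case by simp
next
  case (insert T0 \<T>)
  then obtain w where w: "\<And>T. T \<in> \<T> \<Longrightarrow> (\<Sum>y\<in>Y. w y * u T y) \<noteq> 0"
    by auto
  let ?p = "\<lambda>w T. \<Sum>y\<in>Y. w y * u T y"
  show ?case
  proof (cases "?p w T0 = 0")
    case False
    then show ?thesis using w by auto
  next
    case True
    obtain y0 where y0: "y0 \<in> Y" "u T0 y0 \<noteq> 0"
      using insert.prems by auto
    \<comment> \<open>\<open>e\<close> is a coordinate functional nonzero at \<open>u T0\<close>.
      Since \<open>w\<close> vanishes there, every \<open>e + t w\<close> is nonzero at
      \<open>u T0\<close>, and \<open>t\<close> remains free for the other vectors.\<close>
    define e where "e y = (if y = y0 then 1 else 0 :: 'a)" for y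
    have e: "?p e T = u T y0" for T
      using y0(1) assms(1) by (simp add: e_def if_distrib[of "\<lambda>z. z * _"] cong: if_cong)
    have lin: "?p (\<lambda>y. e y + t * w y) T = u T y0 + t * ?p w T" for t T
      by (simp add: algebra_simps sum.distrib sum_distrib_left flip: e)
    \<comment> \<open>Each \<open>T\<close> in the old family excludes exactly one value of
      \<open>t\<close>, the root of \<open>u T y0 + t * ?p w T\<close>.\<close>
    have "card ((\<lambda>T. - u T y0 / ?p w T) ` \<T>) < CARD('a)"
      using card_image_le[OF insert.hyps(1), of "\<lambda>T. - u T y0 / ?p w T"] insert.prems(1) insert.hyps
      by simp
    then obtain t where t: "t \<notin> (\<lambda>T. - u T y0 / ?p w T) ` \<T>"
      by (metis UNIV_eq_I less_irrefl)
    have "?p (\<lambda>y. e y + t * w y) T \<noteq> 0" if "T \<in> insert T0 \<T>" for T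
    proof (cases "T = T0")
      case True
      then show ?thesis using \<open>?p w T0 = 0\<close> y0(2) lin by simp
    next
      case False
      then have "T \<in> \<T>" using that by simp
      then have "t \<noteq> - u T y0 / ?p w T" using t by blast
      then have "u T y0 + t * ?p w T \<noteq> 0"
        using w[OF \<open>T \<in> \<T>\<close>] by (auto simp: field_simps add_eq_0_iff)
      then show ?thesis using lin by simp
    qed
    then show ?thesis by (intro exI[of _ "\<lambda>y. e y + t * w y"] ballI)
  qed
qed

text \<open>The kernel in \<open>V\<close> and the line through \<open>u\<close> meet only in 0, so
  the translates of the kernel by multiples of \<open>u\<close> are disjoint subsets of
  \<open>V\<close>.\<close>

lemma card_kernel_le:
  fixes V :: "('b \<Rightarrow> 'a::{field,finite}) set"
  assumes "fs.subspace V" "finite V" "u \<in> V" "(\<Sum>y\<in>Y. w y * u y) \<noteq> 0"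
  shows "CARD('a) * card {c \<in> V. (\<Sum>y\<in>Y. w y * c y) = 0} \<le> card V"
proof -
  let ?p = "\<lambda>c. \<Sum>y\<in>Y. w y * c y" and ?f = "\<lambda>(k, c). fscale k u + c"
  let ?V = "{c \<in> V. ?p c = 0}"
  have lin: "?p (fscale k u + c) = k * ?p u + ?p c" for k c
    by (simp add: fscale_def algebra_simps sum.distrib sum_distrib_left)
  have "inj_on ?f (UNIV \<times> ?V)"
  proof (rule inj_onI, clarsimp)
    fix k c k' c'
    assume "?p c = 0" "?p c' = 0" and eq: "fscale k u + c = fscale k' u + c'"
    then have "k * ?p u = k' * ?p u"
      using lin[of k c] lin[of k' c'] by simp
    then have "k = k'" using assms(4) by simp
    then show "k = k' \<and> c = c'" using eq by simp
  qed
  moreover have "?f ` (UNIV \<times> ?V) \<subseteq> V"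
    using assms(1,3) by (auto intro: fs.subspace_add fs.subspace_scale)
  ultimately have "card (UNIV \<times> ?V :: ('a \<times> _) set) \<le> card V"
    using assms(2) by (rule card_inj_on_le)
  then show ?thesis by (simp add: card_cartesian_product)
qed

text \<open>Induction over the parity coordinates \<open>P\<close>. One functional is chosen for
  \<open>x\<close>, common to all \<open>T\<close>; where \<open>x \<in> R T\<close>, passing to its
  kernel divides a nonzero \<open>V T\<close> by the field size, which keeps pace with the loss of
  \<open>x\<close> from \<open>R T\<close>. Once \<open>P\<close> is exhausted, each
  \<open>V T\<close> has at most one element.\<close>

lemma ex_functionals_determining:
  fixes V :: "'t \<Rightarrow> ('b \<Rightarrow> 'a::{field,finite}) set"
  assumes "finite P" "finite Y" "finite \<T>" "card \<T> < CARD('a)"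
    and "\<And>T. T \<in> \<T> \<Longrightarrow> fs.subspace (V T) \<and> determines Y (V T) \<and> R T \<subseteq> P \<and>
                       card (V T) \<le> CARD('a) ^ card (R T)"
  shows "\<exists>W. \<forall>T\<in>\<T>. \<forall>c\<in>V T. (\<forall>x\<in>R T. (\<Sum>y\<in>Y. W x y * c y) = 0) \<longrightarrow> c = 0"
  using assms(1,5)
proof (induction P arbitrary: V R rule: finite_induct)
  case empty
  have "c = 0" if T: "T \<in> \<T>" and c: "c \<in> V T" for T c
  proof -
    have V: "fs.subspace (V T)" "determines Y (V T)" "card (V T) \<le> 1"
      using empty.prems[OF T] by auto
    have "finite (V T)"
      using determines_card_le(1)[OF assms(2) V(1,2)] .
    then show "c = 0"
      using V(3) c fs.subspace_0[OF V(1)] card_le_Suc0_iff_eq by auto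
  qed
  then show ?case by blast
next
  case (insert x P)
  note prems = insert.prems[THEN conjunct1] insert.prems[THEN conjunct2, THEN conjunct1]
    insert.prems[THEN conjunct2, THEN conjunct2, THEN conjunct1]
    insert.prems[THEN conjunct2, THEN conjunct2, THEN conjunct2]
  have fin: "finite (V T)" if "T \<in> \<T>" for T
    using determines_card_le(1)[OF assms(2) prems(1,2)[OF that]] .
  \<comment> \<open>A space that is already zero imposes no condition; each other one contributes a
    single nonzero vector \<open>u T\<close> at which the new functional must not vanish.\<close>
  let ?N = "{T \<in> \<T>. \<exists>u\<in>V T. u \<noteq> 0}"
  obtain u where u: "\<And>T. T \<in> ?N \<Longrightarrow> u T \<in> V T \<and> u T \<noteq> 0"
    using that[of "\<lambda>T. SOME u. u \<in> V T \<and> u \<noteq> 0"] by (smt (verit, best) mem_Collect_eq someI_ex)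
  have "\<exists>w. \<forall>T\<in>?N. (\<Sum>y\<in>Y. w y * u T y) \<noteq> 0"
  proof (rule ex_functional_nonzero[OF assms(2)])
    show "finite ?N" using assms(3) by simp
    show "card ?N < CARD('a)"
      using card_mono[OF assms(3), of ?N] assms(4) by simp
    show "\<exists>y\<in>Y. u T y \<noteq> 0" if "T \<in> ?N" for T
      using u[OF that] prems(2)[of T] that by (auto simp: determines_def)
  qed
  then obtain w where w: "\<And>T. T \<in> ?N \<Longrightarrow> (\<Sum>y\<in>Y. w y * u T y) \<noteq> 0"
    by blast
  \<comment> \<open>The words still undetermined after the parity scalar \<open>x\<close> is known
    to be zero.\<close>
  define V' where "V' T = (if x \<in> R T then {c \<in> V T. (\<Sum>y\<in>Y. w y * c y) = 0} else V T)" for T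
  have "fs.subspace (V' T) \<and> determines Y (V' T) \<and> R T - {x} \<subseteq> P \<and>
          card (V' T) \<le> CARD('a) ^ card (R T - {x})" if T: "T \<in> \<T>" for T
  proof (intro conjI)
    have V: "fs.subspace (V T)" using prems(1)[OF T] .
    have "fs.subspace {c \<in> V T. (\<Sum>y\<in>Y. w y * c y) = 0}"
    proof (rule fs.subspaceI, goal_cases)
      case 1
      then show ?case using fs.subspace_0[OF V] by simp
    next
      case (2 c c')
      then show ?case
        using fs.subspace_add[OF V] by (simp add: algebra_simps sum.distrib)
    next
      case (3 k c)
      then have "(\<Sum>y\<in>Y. w y * fscale k c y) = k * (\<Sum>y\<in>Y. w y * c y)"
        by (simp add: fscale_def algebra_simps flip: sum_distrib_left)
      then show ?case using 3 fs.subspace_scale[OF V] by simp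
    qed
    then show "fs.subspace (V' T)"
      using V by (simp add: V'_def)
    show "determines Y (V' T)"
      using prems(2)[OF T] by (rule determines_mono) (auto simp: V'_def)
    show "R T - {x} \<subseteq> P"
      using prems(3)[OF T] by auto
    have finR: "finite (R T)"
      using prems(3)[OF T] insert.hyps(1) finite_subset by blast
    show "card (V' T) \<le> CARD('a) ^ card (R T - {x})"
    proof (cases "x \<in> R T")
      case False
      then show ?thesis using prems(4)[OF T] by (simp add: V'_def)
    next
      case True
      show ?thesis
      proof (cases "T \<in> ?N")
        case False
        then have "V' T \<subseteq> {0}" using T by (auto simp: V'_def)
        then have "card (V' T) \<le> 1"
          using card_mono[of "{0}" "V' T"] by simp
        also have "\<dots> \<le> CARD('a) ^ card (R T - {x})" by simp
        finally show ?thesis .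
      next
        case N: True
        have "CARD('a) * card (V' T) \<le> card (V T)"
          using card_kernel_le[OF V fin[OF T], of "u T" w Y] u[OF N] w[OF N] True
          by (simp add: V'_def)
        also have "\<dots> \<le> CARD('a) ^ card (R T)" using prems(4)[OF T] .
        also have "card (R T) = Suc (card (R T - {x}))"
          using finR True by (metis card.remove)
        finally show ?thesis by simp
      qed
    qed
  qed
  from insert.IH[of V' "\<lambda>T. R T - {x}", OF this] obtain W where
    W: "\<And>T c. T \<in> \<T> \<Longrightarrow> c \<in> V' T \<Longrightarrow> \<forall>z\<in>R T - {x}. (\<Sum>y\<in>Y. W z y * c y) = 0 \<Longrightarrow> c = 0"
    by blast
  have "c = 0" if "T \<in> \<T>" "c \<in> V T" "\<forall>z\<in>R T. (\<Sum>y\<in>Y. (W(x := w)) z y * c y) = 0" for T c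
  proof (rule W[OF that(1)])
    show "c \<in> V' T" using that(2,3) by (auto simp: V'_def)
    show "\<forall>z\<in>R T - {x}. (\<Sum>y\<in>Y. W z y * c y) = 0"
    proof
      fix z assume "z \<in> R T - {x}"
      then show "(\<Sum>y\<in>Y. W z y * c y) = 0" using that(3)[rule_format, of z] by simp
    qed
  qed
  then show ?case by blast
qed

section \<open>Selecting positions from disjoint blocks\<close>

text \<open>In each block \<open>L\<close> is enlarged to exactly \<open>r\<close> elements,
  independently of the other blocks. This completes the local part of a set of positions to an
  information set of the local codes.\<close>

lemma ex_transversal:
  fixes S :: "'i \<Rightarrow> 'b set"
  assumes "finite A" "disjoint_family_on S A"
    and "\<And>a. a \<in> A \<Longrightarrow> finite (S a) \<and> r \<le> card (S a) \<and> card (L \<inter> S a) \<le> r"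
  shows "\<exists>T \<subseteq> (\<Union>a\<in>A. S a). L \<inter> (\<Union>a\<in>A. S a) \<subseteq> T \<and> card T = card A * r \<and>
           (\<forall>a\<in>A. card (T \<inter> S a) = r)"
proof -
  have "\<exists>B. L \<inter> S a \<subseteq> B \<and> B \<subseteq> S a \<and> card B = r" if "a \<in> A" for a
    using exists_subset_between[of "L \<inter> S a" r "S a"] assms(3)[OF that] by auto
  then obtain B where B: "\<And>a. a \<in> A \<Longrightarrow> L \<inter> S a \<subseteq> B a \<and> B a \<subseteq> S a \<and> card (B a) = r"
    by metis
  have BS: "(\<Union>a\<in>A. B a) \<inter> S a = B a" if "a \<in> A" for a
    using B[OF that] B disjoint_family_onD[OF assms(2)] that by (auto, blast)
  have "disjoint_family_on B A"
    using B assms(2) unfolding disjoint_family_on_def by blast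
  then have "card (\<Union>a\<in>A. B a) = (\<Sum>a\<in>A. card (B a))"
    using assms(1) finite_subset[OF conjunct1[OF conjunct2[OF B]]] assms(3)
    unfolding disjoint_family_on_def by (intro card_UN_disjoint) auto
  also have "\<dots> = card A * r" using B by simp
  finally have card: "card (\<Union>a\<in>A. B a) = card A * r" .
  show ?thesis
  proof (intro exI[of _ "\<Union>a\<in>A. B a"] conjI ballI card)
    show "(\<Union>a\<in>A. B a) \<subseteq> (\<Union>a\<in>A. S a)" "L \<inter> (\<Union>a\<in>A. S a) \<subseteq> (\<Union>a\<in>A. B a)"
      using B by blast+
    show "card ((\<Union>a\<in>A. B a) \<inter> S a) = r" if "a \<in> A" for a
      using B[OF that] BS[OF that] by simp
  qed
qed

text \<open>If \<open>Z\<close> has at least \<open>r\<close> elements in every block,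
  \<open>r\<close> from each suffice. Otherwise some block \<open>b\<close> is short and loses
  nothing when every block is trimmed to \<open>r\<close> elements; each other block loses at most
  \<open>e\<close>, so enough of \<open>Z\<close> survives.\<close>

lemma ex_subset_few_per_block:
  fixes S :: "'i \<Rightarrow> 'b set"
  assumes A: "finite A" "disjoint_family_on S A"
    and S: "\<And>a. a \<in> A \<Longrightarrow> finite (S a) \<and> card (S a) = r + e"
    and Z: "finite Z" "card Z \<ge> card A * r + (card A - 1) * e"
  shows "\<exists>T\<subseteq>Z. card T = card A * r \<and> (\<forall>a\<in>A. card (T \<inter> S a) \<le> r)"
proof (cases "\<forall>a\<in>A. r \<le> card (Z \<inter> S a)")
  case True
  have "disjoint_family_on (\<lambda>a. Z \<inter> S a) A"
    using A(2) unfolding disjoint_family_on_def by blast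
  from ex_transversal[OF A(1) this, of r "{}"] Z(1) True
  obtain T where T: "T \<subseteq> (\<Union>a\<in>A. Z \<inter> S a)" "card T = card A * r"
    "\<forall>a\<in>A. card (T \<inter> (Z \<inter> S a)) = r" by auto
  have "T \<inter> (Z \<inter> S a) = T \<inter> S a" for a using T(1) by auto
  then show ?thesis using T by (intro exI[of _ T]) auto
next
  case False
  then obtain b where b: "b \<in> A" "card (Z \<inter> S b) < r" by auto
  have "\<exists>B\<subseteq>Z \<inter> S a. card B = min r (card (Z \<inter> S a))" for a
    by (meson min.cobounded2 obtain_subset_with_card_n)
  then obtain B where B: "\<And>a. B a \<subseteq> Z \<inter> S a" "\<And>a. card (B a) = min r (card (Z \<inter> S a))"
    by metis
  define Z' where "Z' = Z - (\<Union>a\<in>A. Z \<inter> S a - B a)"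
  \<comment> \<open>The short block needs no trimming; this turns \<open>card A\<close> into
    \<open>card A - 1\<close> in the number of discarded elements.\<close>
  have "B b = Z \<inter> S b"
    using card_subset_eq[OF _ B(1)[of b]] Z(1) B(2)[of b] b by simp
  then have "(\<Union>a\<in>A. Z \<inter> S a - B a) = (\<Union>a\<in>A - {b}. Z \<inter> S a - B a)" by blast
  then have "card (\<Union>a\<in>A. Z \<inter> S a - B a) \<le> (\<Sum>a\<in>A - {b}. card (Z \<inter> S a - B a))"
    using A(1) by (simp add: card_UN_le)
  also have "\<dots> \<le> (\<Sum>a\<in>A - {b}. e)"
  proof (rule sum_mono)
    fix a assume "a \<in> A - {b}"
    then have "card (Z \<inter> S a) \<le> r + e"
      using S[of a] card_mono[of "S a" "Z \<inter> S a"] by auto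
    then show "card (Z \<inter> S a - B a) \<le> e"
      using B[of a] Z(1) by (subst card_Diff_subset) (auto intro: finite_subset)
  qed
  also have "\<dots> = (card A - 1) * e" using b(1) A(1) by simp
  finally have "card (\<Union>a\<in>A. Z \<inter> S a - B a) \<le> (card A - 1) * e" .
  moreover have "card Z - card (\<Union>a\<in>A. Z \<inter> S a - B a) \<le> card Z'"
    unfolding Z'_def using A(1) Z(1) by (intro diff_card_le_card_Diff) auto
  ultimately have "card A * r \<le> card Z'"
    using Z(2) by linarith
  then obtain T where T: "T \<subseteq> Z'" "card T = card A * r"
    by (meson obtain_subset_with_card_n)
  have "card (T \<inter> S a) \<le> r" if "a \<in> A" for a
  proof -
    have "T \<inter> S a \<subseteq> B a" using T(1) that unfolding Z'_def by blast
    moreover have "finite (B a)" using B(1)[of a] Z(1) finite_subset by blast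
    ultimately have "card (T \<inter> S a) \<le> card (B a)" by (rule card_mono[rotated])
    then show ?thesis using B(2)[of a] by simp
  qed
  then show ?thesis using T unfolding Z'_def by blast
qed


section \<open>Weights and basic properties of MSR codes\<close>

lemma subspace_image:
  fixes f :: "('b \<Rightarrow> 'a::field) \<Rightarrow> 'c \<Rightarrow> 'a"
  assumes "fs.subspace C" "\<And>c c'. f (c + c') = f c + f c'" "\<And>k c. f (fscale k c) = fscale k (f c)"
  shows "fs.subspace (f ` C)"
proof (rule fs.subspaceI)
  have "f (fscale 0 0) = fscale 0 (f 0)" by (rule assms(3))
  then have "f 0 = 0" by simp
  then show "0 \<in> f ` C" using fs.subspace_0[OF assms(1)] by force
next
  fix x y assume "x \<in> f ` C" "y \<in> f ` C"
  then show "x + y \<in> f ` C"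
    using fs.subspace_add[OF assms(1)] by (auto simp flip: assms(2))
next
  fix k x assume "x \<in> f ` C"
  then show "fscale k x \<in> f ` C"
    using fs.subspace_scale[OF assms(1)] by (auto simp flip: assms(3))
qed

lemma dim_eqI:
  fixes C :: "('b \<Rightarrow> 'a::{field,finite}) set"
  assumes "finite C" "fs.subspace C" "card C = CARD('a) ^ K"
  shows "fs.dim C = K"
  using card_subspace[OF assms(1,2)] assms(3) power_CARD_inject[where 'a='a] by simp

lemma subspace_word_space: "fs.subspace (word_space I \<alpha>)"
  by (rule fs.subspaceI) (auto simp: word_space_def fscale_def)

lemma curry_eq_0_iff: "curry c i = 0 \<longleftrightarrow> (\<forall>j. c (i, j) = 0)"
  by (auto simp: fun_eq_iff)

lemma curry_eq_0_word_space:
  "c \<in> word_space I \<alpha> \<Longrightarrow> curry c i = 0 \<longleftrightarrow> (\<forall>j<\<alpha>. c (i, j) = 0)"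
  by (auto simp: curry_eq_0_iff word_space_def)

lemma weight_eq_diff:
  assumes "finite I" "c \<in> word_space I \<alpha>"
  shows "weight c = card I - card {i \<in> I. curry c i = 0}"
proof -
  have "curry c i = 0" if "i \<notin> I" for i
    using assms that by (simp add: word_space_def curry_eq_0_iff)
  then have "{i. curry c i \<noteq> 0} = I - {i \<in> I. curry c i = 0}" by blast
  then show ?thesis
    using assms(1) by (simp add: weight_def card_Diff_subset)
qed

lemma msr_code_facts:
  fixes C :: "'a::{field,finite} word set"
  assumes "msr_code I k d \<alpha> \<beta> C"
  shows "finite I" "\<alpha> \<ge> 1" "fs.subspace C" "C \<subseteq> word_space I \<alpha>" "finite C"
    "card C = CARD('a) ^ (k * \<alpha>)" "fs.dim C = k * \<alpha>" "k \<le> d" "d < card I" "k < card I"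
proof -
  show 1: "finite I" "\<alpha> \<ge> 1" "fs.subspace C" "C \<subseteq> word_space I \<alpha>" "fs.dim C = k * \<alpha>"
    "k \<le> d" "d < card I"
    using assms by (auto simp: msr_code_def regenerating_code_def vector_code_def)
  show "finite C"
    using determines_card_le(1)[OF _ 1(3) word_space_determined[OF 1(4)]] 1(1) by simp
  then show "card C = CARD('a) ^ (k * \<alpha>)"
    using card_subspace 1(3,5) by metis
  show "k < card I" using 1(6,7) by simp
qed

lemma msr_code_determined:
  fixes C :: "'a::{field,finite} word set"
  assumes "msr_code I k d \<alpha> \<beta> C" "T \<subseteq> I" "card T = k"
  shows "determines (T \<times> {..<\<alpha>}) C"
  unfolding determines_def
proof (intro ballI impI)
  fix c assume c: "c \<in> C" "\<forall>x\<in>T \<times> {..<\<alpha>}. c x = 0"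
  note facts = msr_code_facts[OF assms(1)]
  have "curry c h = curry 0 h" if "h \<in> T" for h
    using c that facts(4) curry_eq_0_word_space[of c I \<alpha> h] curry_eq_0_iff[of 0 h] by auto
  then show "c = 0"
    using assms c(1) fs.subspace_0[OF facts(3)]
    unfolding msr_code_def regenerating_code_def by blast
qed

text \<open>The MDS property: any \<open>k\<close> symbols determine the codeword, so a nonzero word
  has at most \<open>k - 1\<close> zero symbols.\<close>

lemma msr_code_min_dist:
  fixes C :: "'a::{field,finite} word set"
  assumes "msr_code I k d \<alpha> \<beta> C" "k \<ge> 1"
  shows "card I - k + 1 \<le> min_dist C"
  unfolding min_dist_def
proof (rule cINF_greatest)
  note facts = msr_code_facts[OF assms(1)]
  \<comment> \<open>A nonzero codeword exists, hence the infimum is not the dummy value 0.\<close>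
  have "1 < card C"
    using facts(2,6) assms(2) CARD_gt_1[where 'a='a] one_less_power[of "CARD('a)" "k * \<alpha>"] by simp
  then show "C - {0} \<noteq> {}"
    by (metis Diff_eq_empty_iff card.empty card_mono finite.emptyI finite_insert
        is_singletonI is_singleton_altdef leD)
  fix c assume c: "c \<in> C - {0}"
  let ?Z = "{i \<in> I. curry c i = 0}"
  have weight: "weight c = card I - card ?Z"
    using weight_eq_diff[OF facts(1)] c facts(4) by blast
  show "card I - k + 1 \<le> weight c"
  proof (rule ccontr)
    assume "\<not> card I - k + 1 \<le> weight c"
    then have "k \<le> card ?Z" using weight facts(10) by linarith
    then obtain T where T: "T \<subseteq> ?Z" "card T = k" by (meson obtain_subset_with_card_n)
    then have "determines (T \<times> {..<\<alpha>}) C"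
      using msr_code_determined[OF assms(1), of T] by blast
    then show False
      using c T(1) by (auto simp: determines_def curry_eq_0_iff)
  qed
qed

section \<open>Translating codes along the positions\<close>

text \<open>Shift of a word by \<open>s\<close> positions to the right. Punctured codes keep their
  positions, so each local code is a shifted copy of the given MSR code.\<close>

definition place :: "nat \<Rightarrow> 'a::zero word \<Rightarrow> 'a word" where
  "place s c = (\<lambda>(i, j). if s \<le> i then c (i - s, j) else 0)"

lemma curry_place: "s \<le> i \<Longrightarrow> curry (place s c) i = curry c (i - s)"
  by (auto simp: place_def fun_eq_iff)

lemma inj_place: "inj (place s)"
proof (rule injI)
  fix c c' :: "'a word" assume "place s c = place s c'"
  then have "place s c (i + s, j) = place s c' (i + s, j)" for i j by simp
  then show "c = c'" by (auto simp: place_def fun_eq_iff)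
qed

text \<open>Truncated subtraction of \<open>s\<close> is injective here since all of
  \<open>S\<close> lies beyond \<open>s\<close>.\<close>

lemma shift_block:
  fixes s N :: nat
  assumes "S \<subseteq> {s + 1..s + N}"
  shows "(\<lambda>x. x - s) ` S \<subseteq> {1..N}" "card ((\<lambda>x. x - s) ` S) = card S" "x \<in> S \<Longrightarrow> s < x"
proof -
  show "(\<lambda>x. x - s) ` S \<subseteq> {1..N}" "x \<in> S \<Longrightarrow> s < x" using assms by fastforce+
  have "inj_on (\<lambda>x. x - s) S"
    using assms by (intro inj_onI) (force simp: subset_iff)
  then show "card ((\<lambda>x. x - s) ` S) = card S" by (rule card_image)
qed

text \<open>Sets of positions, repair maps and words are pulled back along the shift, where the
  properties of \<open>C\<close> apply.\<close>

lemma msr_code_place: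
  fixes C :: "'a::{field,finite} word set"
  assumes C: "msr_code {1..N} k d \<alpha> \<beta> C" and k: "k \<ge> 1"
  shows "msr_code {s + 1..s + N} k d \<alpha> \<beta> (place s ` C)"
proof -
  let ?I = "{s + 1..s + N}" and ?C = "place s ` C"
  note facts = msr_code_facts[OF C]
  have subsp: "fs.subspace ?C"
    by (rule subspace_image[OF facts(3)]) (auto simp: place_def fscale_def fun_eq_iff)
  have sub: "?C \<subseteq> word_space ?I \<alpha>"
  proof
    fix x assume "x \<in> ?C"
    then obtain c where c: "c \<in> C" "x = place s c" by auto
    have "c (i, j) = 0" if "i \<notin> {1..N} \<or> \<not> j < \<alpha>" for i j
      using facts(4) c(1) that by (auto simp: word_space_def)
    then show "x \<in> word_space ?I \<alpha>"
      by (auto simp: c(2) word_space_def place_def)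
  qed
  have card: "card ?C = CARD('a) ^ (k * \<alpha>)"
    using card_image[OF inj_on_subset[OF inj_place subset_UNIV], of s C] facts(6) by simp
  have dim: "fs.dim ?C = k * \<alpha>"
    using dim_eqI[OF _ subsp card] facts(5) by simp
  have recover: "c = c'" if S: "S \<subseteq> ?I" "card S = k" and c: "c \<in> ?C" "c' \<in> ?C"
    and eq: "\<forall>h\<in>S. curry c h = curry c' h" for S c c'
  proof -
    obtain b b' where b: "b \<in> C" "c = place s b" "b' \<in> C" "c' = place s b'" using c by auto
    have "\<forall>h\<in>(\<lambda>x. x - s) ` S. curry b h = curry b' h"
    proof clarify
      fix x assume x: "x \<in> S"
      then have "s \<le> x" using shift_block(3)[OF S(1)] less_imp_le by blast
      then show "curry b (x - s) = curry b' (x - s)"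
        using eq[rule_format, OF x] b(2,4) by (simp add: curry_place)
    qed
    then have "b = b'"
      using C b(1,3) shift_block(1,2)[OF S(1)] S(2)
      unfolding msr_code_def regenerating_code_def by metis
    then show ?thesis using b by simp
  qed
  have repair: "repairable ?C \<alpha> \<beta> D i" if i: "i \<in> ?I" and D: "D \<subseteq> ?I - {i}" "card D = d" for i D
  proof -
    have DI: "D \<subseteq> ?I" using D(1) by auto
    have "(\<lambda>x. x - s) ` D \<subseteq> {1..N} - {i - s}" "i - s \<in> {1..N}"
      using i D(1) by (force simp: subset_iff)+
    then have "repairable C \<alpha> \<beta> ((\<lambda>x. x - s) ` D) (i - s)"
      using C D(2) shift_block(2)[OF DI] by (auto simp: msr_code_def regenerating_code_def)
    then obtain \<phi> :: "nat \<Rightarrow> (nat \<Rightarrow> 'a) \<Rightarrow> nat \<Rightarrow> 'a" where \<phi>: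
      "(\<forall>h\<in>(\<lambda>x. x - s) ` D. Vector_Spaces.linear fscale fscale (\<phi> h) \<and>
                \<phi> h ` coord_space \<alpha> \<subseteq> coord_space \<beta>) \<and>
       (\<forall>c\<in>C. \<forall>c'\<in>C. (\<forall>h\<in>(\<lambda>x. x - s) ` D. \<phi> h (curry c h) = \<phi> h (curry c' h)) \<longrightarrow>
          curry c (i - s) = curry c' (i - s))"
      unfolding repairable_def by (elim exE)
    note lin = \<phi>[THEN conjunct1, rule_format]
      and rep = \<phi>[THEN conjunct2, THEN bspec, THEN bspec, THEN mp]
    show ?thesis
      unfolding repairable_def
    \<comment> \<open>The helper at \<open>h\<close> uses the repair map of its original position
      \<open>h - s\<close>.\<close>
    proof (intro exI[of _ "\<lambda>h. \<phi> (h - s)"] conjI ballI impI)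
      fix h assume "h \<in> D"
      then show "Vector_Spaces.linear fscale fscale (\<phi> (h - s))"
        "\<phi> (h - s) ` coord_space \<alpha> \<subseteq> coord_space \<beta>"
        using lin[OF imageI] by auto
    next
      fix c c' assume c: "c \<in> ?C" "c' \<in> ?C"
        and eq: "\<forall>h\<in>D. \<phi> (h - s) (curry c h) = \<phi> (h - s) (curry c' h)"
      obtain b b' where b: "b \<in> C" "c = place s b" "b' \<in> C" "c' = place s b'" using c by auto
      have "\<forall>h\<in>(\<lambda>x. x - s) ` D. \<phi> h (curry b h) = \<phi> h (curry b' h)"
      proof clarify
        fix x assume x: "x \<in> D"
        then have "s \<le> x" using shift_block(3)[OF DI] less_imp_le by blast
        then show "\<phi> (x - s) (curry b (x - s)) = \<phi> (x - s) (curry b' (x - s))"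
          using eq[rule_format, OF x] b(2,4) by (simp add: curry_place)
      qed
      then show "curry c i = curry c' i"
        using rep[OF b(1,3)] b(2,4) i by (simp add: curry_place)
    qed
  qed
  have "vector_code ?I \<alpha> ?C"
  proof (rule vector_code_if_determined[OF _ facts(2) subsp sub])
    fix i assume i: "i \<in> ?I"
    have "\<exists>T. {i} \<subseteq> T \<and> T \<subseteq> ?I \<and> card T = k"
      using i k facts(10) exists_subset_between[of "{i}" k ?I] by auto
    then obtain T where T: "i \<in> T" "T \<subseteq> ?I" "card T = k" by auto
    have "determines (T \<times> {..<\<alpha>}) ?C"
      unfolding determines_def
    proof (intro ballI impI)
      fix c assume c: "c \<in> ?C" "\<forall>x\<in>T \<times> {..<\<alpha>}. c x = 0"
      have "\<forall>h\<in>T. curry c h = curry 0 h"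
      proof
        fix h assume "h \<in> T"
        then have "curry c h = 0"
          using c curry_eq_0_word_space[of c ?I \<alpha> h] sub by auto
        then show "curry c h = curry 0 h" by (simp add: fun_eq_iff)
      qed
      then show "c = 0"
        using recover[OF T(2,3) c(1) fs.subspace_0[OF subsp]] by simp
    qed
    then show "\<exists>T. i \<in> T \<and> T \<subseteq> ?I \<and> card T * \<alpha> = fs.dim ?C \<and> determines (T \<times> {..<\<alpha>}) ?C"
      using T dim by auto
  qed simp
  moreover have "\<alpha> = (d - k + 1) * \<beta>" using C by (simp add: msr_code_def)
  moreover have "d < card ?I" using facts(9) by simp
  ultimately show ?thesis
    unfolding msr_code_def regenerating_code_def
    by (intro conjI allI ballI impI dim facts(8))  (assumption | erule (4) recover | erule (2) repair)+
qed

text \<open>Counterpart of \<open>place\<close>: the \<open>N\<close> symbols after position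
  \<open>s\<close>, renumbered from 1. Puncturing to a block is \<open>block\<close> followed by
  \<open>place\<close>.\<close>

definition block :: "nat \<Rightarrow> nat \<Rightarrow> 'a::zero word \<Rightarrow> 'a word" where
  "block N s c = (\<lambda>(i, j). if i \<in> {1..N} then c (s + i, j) else 0)"

lemma block_0: "block N s 0 = 0"
  and block_add: "block N s (c + c') = block N s c + block N s (c' :: 'a::field word)"
  and block_scale: "block N s (fscale k c) = fscale k (block N s c)"
  by (auto simp: block_def fscale_def fun_eq_iff)

lemma puncture_eq_place_block:
  "puncture {s + 1..s + N} C = place s ` block N s ` C"
  unfolding puncture_def image_image
  by (intro image_cong refl) (auto simp: place_def block_def fun_eq_iff)

section \<open>The construction: copies of the MSR code with parity symbols\<close>

text \<open>Here \<open>e\<close> stands for \<open>\<delta> - 1\<close>, the excess of the block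
  length \<open>N\<close> over \<open>r\<close>.\<close>

locale msr_blocks =
  fixes C0 :: "'a::{field,finite} word set" and N r e m n d \<alpha> \<beta> :: nat
  assumes r: "r \<ge> 1" and m: "m \<ge> 1" and N: "N = r + e" and mN: "m * N \<le> n"
    and C0: "msr_code {1..N} r d \<alpha> \<beta> C0"
begin

definition blk :: "nat \<Rightarrow> nat set" where "blk a = {a * N + 1..a * N + N}"

text \<open>The direct sum of \<open>m\<close> copies of \<open>C0\<close>, on consecutive blocks of
  positions.\<close>

definition base :: "'a word set" where
  "base = {c \<in> word_space {1..m * N} \<alpha>. \<forall>a<m. block N (a * N) c \<in> C0}"

text \<open>Systematic encoding: local symbols are kept, and row \<open>W x\<close> holds the
  coefficients of the parity scalar \<open>x\<close>. The \<alpha> scalars of one parity symbol have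
  separate functionals.\<close>

definition extend :: "(nat \<times> nat \<Rightarrow> nat \<times> nat \<Rightarrow> 'a) \<Rightarrow> 'a word \<Rightarrow> 'a word" where
  "extend W c = (\<lambda>x. if x \<in> {m * N + 1..n} \<times> {..<\<alpha>}
     then \<Sum>y\<in>{1..m * N} \<times> {..<\<alpha>}. W x y * c y else c x)"

definition good :: "nat set \<Rightarrow> bool" where
  "good T \<longleftrightarrow> T \<subseteq> {1..n} \<and> card T = m * r \<and> (\<forall>a<m. card (T \<inter> blk a) \<le> r)"

definition determining :: "(nat \<times> nat \<Rightarrow> nat \<times> nat \<Rightarrow> 'a) \<Rightarrow> bool" where
  "determining W \<longleftrightarrow> (\<forall>T. good T \<longrightarrow> determines (T \<times> {..<\<alpha>}) (extend W ` base))"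

text \<open>Assembles a word from its blocks. Positions start at 1 and block indices at 0, hence the
  shifts around \<open>div\<close> and \<open>mod\<close>.\<close>

definition glue :: "(nat \<Rightarrow> 'a word) \<Rightarrow> 'a word" where
  "glue f = (\<lambda>(i, j). if i \<in> {1..m * N} then f ((i - 1) div N) ((i - 1) mod N + 1, j) else 0)"

lemmas C0_facts = msr_code_facts[OF C0]

lemma N_pos: "N > 0" using r N by simp

lemma C0_outside: "c \<in> C0 \<Longrightarrow> i \<notin> {1..N} \<or> \<not> j < \<alpha> \<Longrightarrow> c (i, j) = 0"
  using C0_facts(4) by (auto simp: word_space_def)

lemma finite_blk: "finite (blk a)" and card_blk: "card (blk a) = N"
  by (auto simp: blk_def)

lemma blk_bound: "a < m \<Longrightarrow> a * N + N \<le> m * N"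
  using mult_le_mono1[of "Suc a" m N] by simp

text \<open>The condition \<open>i \<ge> 1\<close> keeps out position 0, which truncated subtraction
  would send to block 0.\<close>

lemma mem_blk_iff: "i \<in> blk a \<longleftrightarrow> i \<ge> 1 \<and> (i - 1) div N = a"
proof -
  have "(i - 1) div N = a \<longleftrightarrow> a * N \<le> i - 1 \<and> i - 1 < a * N + N"
    using N_pos by (metis div_nat_eqI div_times_less_eq_dividend dividend_less_div_times mult.commute
        mult_Suc_right add.commute)
  moreover have "i \<in> blk a \<longleftrightarrow> i \<ge> 1 \<and> a * N \<le> i - 1 \<and> i - 1 < a * N + N"
    by (auto simp: blk_def)
  ultimately show ?thesis by simp
qed

lemma disjoint_blk: "disjoint_family_on blk A"
  by (auto simp: disjoint_family_on_def mem_blk_iff)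

lemma UN_blk: "(\<Union>a<m. blk a) = {1..m * N}"
proof -
  have "i - 1 < m * N \<longleftrightarrow> (i - 1) div N < m" for i
    using N_pos by (simp add: div_less_iff_less_mult)
  moreover have "i \<le> m * N \<longleftrightarrow> i - 1 < m * N" for i
    using m N_pos nat_0_less_mult_iff[of m N] by linarith
  ultimately show ?thesis by (auto simp: mem_blk_iff)
qed

lemma base_outside: "c \<in> base \<Longrightarrow> i \<notin> {1..m * N} \<or> \<not> j < \<alpha> \<Longrightarrow> c (i, j) = 0"
  by (auto simp: base_def word_space_def)

lemma subspace_base: "fs.subspace base"
proof (rule fs.subspaceI)
  show "0 \<in> base"
    using fs.subspace_0[OF C0_facts(3)] by (simp add: base_def word_space_def block_0)
next
  fix c c' assume "c \<in> base" "c' \<in> base"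
  then show "c + c' \<in> base"
    using fs.subspace_add[OF C0_facts(3)] by (simp add: base_def word_space_def block_add)
next
  fix k c assume "c \<in> base"
  moreover from this have "fscale k c \<in> word_space {1..m * N} \<alpha>"
    by (intro fs.subspace_scale[OF subspace_word_space]) (simp add: base_def)
  ultimately show "fscale k c \<in> base"
    using fs.subspace_scale[OF C0_facts(3)] by (simp add: base_def block_scale)
qed

text \<open>Blocks are independent, and \<open>r\<close> zero symbols in a block annihilate its word
  of \<open>C0\<close>.\<close>

lemma base_determined:
  assumes "\<And>a. a < m \<Longrightarrow> card (T \<inter> blk a) = r"
  shows "determines (T \<times> {..<\<alpha>}) base"
  unfolding determines_def
proof (intro ballI impI)
  fix c assume c: "c \<in> base" "\<forall>x\<in>T \<times> {..<\<alpha>}. c x = 0"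
  have zero: "c (i, j) = 0" if "a < m" "i \<in> blk a" for a i j
  proof -
    let ?T = "(\<lambda>x. x - a * N) ` (T \<inter> blk a)"
    have sub: "T \<inter> blk a \<subseteq> {a * N + 1..a * N + N}" by (auto simp: blk_def)
    have "determines (?T \<times> {..<\<alpha>}) C0"
      using msr_code_determined[OF C0 shift_block(1)[OF sub]] shift_block(2)[OF sub]
        assms[OF that(1)] by simp
    moreover have "\<forall>x\<in>?T \<times> {..<\<alpha>}. block N (a * N) c x = 0"
      using c(2) sub by (auto simp: block_def)
    ultimately have "block N (a * N) c = 0"
      using c(1) that(1) by (auto simp: determines_def base_def)
    then have "block N (a * N) c (i - a * N, j) = 0" by simp
    then show ?thesis using that(2) by (auto simp: block_def blk_def split: if_splits)
  qed
  have "c (i, j) = 0" for i j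
    using zero[of _ i j] base_outside[OF c(1), of i j] UN_blk by blast
  then show "c = 0" by (auto simp: fun_eq_iff)
qed

section \<open>Choice of the parity functionals\<close>

lemma ex_transversal_blk:
  assumes "\<And>a. a < m \<Longrightarrow> card (L \<inter> blk a) \<le> r"
  obtains T where "T \<subseteq> {1..m * N}" "L \<inter> {1..m * N} \<subseteq> T" "card T = m * r"
    "\<And>a. a < m \<Longrightarrow> card (T \<inter> blk a) = r"
  using ex_transversal[of "{..<m}" blk r L] assms disjoint_blk finite_blk card_blk N UN_blk by auto

lemma ex_good_functionals:
  assumes "CARD('a) > n choose (m * r)"
  shows "\<exists>W. determining W"
proof -
  let ?Y = "{1..m * N} \<times> {..<\<alpha>}" and ?P = "{m * N + 1..n} \<times> {..<\<alpha>}"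
  \<comment> \<open>\<open>V T\<close> collects the base words that the local symbols of
    \<open>T\<close> leave undetermined; \<open>R T\<close> are the parity scalars of
    \<open>T\<close> that have to single out 0 among them.\<close>
  define V where "V T = {c \<in> base. \<forall>x\<in>(T \<inter> {1..m * N}) \<times> {..<\<alpha>}. c x = 0}" for T
  define R where "R T = (T \<inter> {m * N + 1..n}) \<times> {..<\<alpha>}" for T
  have sub: "Collect good \<subseteq> {T. T \<subseteq> {1..n} \<and> card T = m * r}"
    unfolding good_def by blast
  have fin: "finite (Collect good)"
    by (rule finite_subset[OF sub]) simp
  have card: "card (Collect good) < CARD('a)"
    using card_mono[OF _ sub] n_subsets[of "{1..n}" "m * r"] assms by simp
  have "fs.subspace (V T) \<and> determines ?Y (V T) \<and> R T \<subseteq> ?P \<and> card (V T) \<le> CARD('a) ^ card (R T)"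
    if T: "T \<in> Collect good" for T
  proof -
    have subsp: "fs.subspace (V T)"
      using fs.subspace_0[OF subspace_base] fs.subspace_add[OF subspace_base]
        fs.subspace_scale[OF subspace_base]
      by (intro fs.subspaceI) (auto simp: V_def fscale_def)
    have det: "determines ?Y (V T)"
      by (rule determines_mono[OF word_space_determined]) (auto simp: V_def base_def)
    have finT: "finite T" and Tn: "T \<subseteq> {1..n}" and cardT: "card T = m * r"
      using T finite_subset[of T "{1..n}"] by (auto simp: good_def)
    \<comment> \<open>A word of \<open>V T\<close> is fixed by its symbols at the positions added to
      complete the local part of \<open>T\<close>. Since \<open>T\<close> and \<open>T0\<close> both
      have \<open>m * r\<close> elements, these are as many as the parity positions in
      \<open>T\<close>.\<close>
    obtain T0 where T0: "T0 \<subseteq> {1..m * N}" "T \<inter> {1..m * N} \<subseteq> T0" "card T0 = m * r"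
      "\<And>a. a < m \<Longrightarrow> card (T0 \<inter> blk a) = r"
      using ex_transversal_blk[of T] T by (auto simp: good_def)
    let ?D = "T0 - T \<inter> {1..m * N}"
    have "determines (?D \<times> {..<\<alpha>}) (V T)"
      using base_determined[OF T0(4)] by (force simp: determines_def V_def)
    then have "card (V T) \<le> CARD('a) ^ (card ?D * \<alpha>)"
      using determines_card_le(2)[OF _ subsp, of "?D \<times> {..<\<alpha>}"] finite_subset[OF T0(1)]
      by (simp add: card_cartesian_product)
    also have "card ?D = m * r - card (T \<inter> {1..m * N})"
      using T0 finT by (simp add: card_Diff_subset)
    also have "\<dots> = card (T \<inter> {m * N + 1..n})"
    proof -
      have "T = (T \<inter> {1..m * N}) \<union> (T \<inter> {m * N + 1..n})" using Tn by auto
      then have "card T = card (T \<inter> {1..m * N}) + card (T \<inter> {m * N + 1..n})"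
        using finT by (metis (no_types, lifting) card_Un_disjoint disjoint_iff IntE atLeastAtMost_iff
            finite_Int not_less_eq_eq Suc_eq_plus1)
      then show ?thesis using cardT by simp
    qed
    finally have "card (V T) \<le> CARD('a) ^ card (R T)"
      by (simp add: R_def card_cartesian_product)
    then show ?thesis using subsp det by (auto simp: R_def)
  qed
  from ex_functionals_determining[of ?P ?Y "Collect good" V R, OF _ _ fin card this]
  obtain W where W: "\<And>T c. good T \<Longrightarrow> c \<in> V T \<Longrightarrow>
      (\<forall>x\<in>R T. (\<Sum>y\<in>?Y. W x y * c y) = 0) \<Longrightarrow> c = 0" by auto
  have "determines (T \<times> {..<\<alpha>}) (extend W ` base)" if T: "good T" for T
    unfolding determines_def
  proof (intro ballI impI)
    fix x assume "x \<in> extend W ` base" and zero: "\<forall>y\<in>T \<times> {..<\<alpha>}. x y = 0"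
    then obtain c where c: "c \<in> base" "x = extend W c" by auto
    have "c \<in> V T"
      unfolding V_def
    proof (clarsimp simp: c(1))
      fix i j assume "i \<in> T" "Suc 0 \<le> i" "i \<le> m * N" "j < \<alpha>"
      then show "c (i, j) = 0" using zero[rule_format, of "(i, j)"] by (simp add: c(2) extend_def)
    qed
    moreover have "(\<Sum>y\<in>?Y. W z y * c y) = 0" if "z \<in> R T" for z
    proof -
      have "z \<in> T \<times> {..<\<alpha>}" "z \<in> ?P" using that by (auto simp: R_def)
      then show ?thesis using zero unfolding c(2) extend_def by (metis (no_types, lifting))
    qed
    ultimately have "c = 0" using W[OF T] by blast
    then show "x = 0" by (intro ext) (simp add: c(2) extend_def)
  qed
  then show ?thesis unfolding determining_def by blast
qed

lemma determining_good: "determining W \<Longrightarrow> good T \<Longrightarrow> determines (T \<times> {..<\<alpha>}) (extend W ` base)"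
  by (simp add: determining_def)

section \<open>Size of the direct sum\<close>

lemma block_glue:
  assumes "a < m" "f a \<in> C0"
  shows "block N (a * N) (glue f) = f a"
proof -
  have "block N (a * N) (glue f) (i, j) = f a (i, j)" for i j
  proof (cases "i \<in> {1..N}")
    case True
    then have "a * N + i \<in> blk a" by (auto simp: blk_def)
    then have 1: "(a * N + i - 1) div N = a" by (simp add: mem_blk_iff)
    have "(a * N + i - 1) mod N = i - 1"
      using True mod_mult_self3[of a N "i - 1"] by (auto simp: add_diff_assoc2)
    then show ?thesis
      using True 1 blk_bound[OF assms(1)] by (auto simp: block_def glue_def)
  next
    case False
    then show ?thesis using C0_outside[OF assms(2)] by (auto simp: block_def)
  qed
  then show ?thesis by (auto simp: fun_eq_iff)
qed

lemma glue_in_base: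
  assumes "\<And>a. a < m \<Longrightarrow> f a \<in> C0"
  shows "glue f \<in> base"
proof -
  have "glue f (i, j) = 0" if "i \<notin> {1..m * N} \<or> \<not> j < \<alpha>" for i j
  proof (cases "i \<in> {1..m * N}")
    case True
    then have "(i - 1) div N < m" using UN_blk by (auto simp: mem_blk_iff)
    then show ?thesis using True that assms C0_outside by (auto simp: glue_def)
  qed (auto simp: glue_def)
  then show ?thesis
    using block_glue assms by (auto simp: base_def word_space_def)
qed

text \<open>A transversal with \<open>r\<close> positions per block bounds the size from above;
  gluing arbitrary \<open>m\<close>-tuples of words of \<open>C0\<close> bounds it from
  below.\<close>

lemma finite_base: "finite base" and card_base: "card base = CARD('a) ^ (m * r * \<alpha>)"
proof -
  obtain T where T: "T \<subseteq> {1..m * N}" "card T = m * r" "\<And>a. a < m \<Longrightarrow> card (T \<inter> blk a) = r"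
    using ex_transversal_blk[of "{}"] by auto
  note le = determines_card_le[OF _ subspace_base base_determined[OF T(3)]]
  show fin: "finite base" using le(1) finite_subset[OF T(1)] by simp
  have "inj_on glue ({..<m} \<rightarrow>\<^sub>E C0)"
  proof (rule inj_onI)
    fix f g assume fg: "f \<in> {..<m} \<rightarrow>\<^sub>E C0" "g \<in> {..<m} \<rightarrow>\<^sub>E C0" "glue f = glue g"
    have "f a = g a" if "a < m" for a
      using block_glue[OF that, of f] block_glue[OF that, of g] fg that by (auto simp: PiE_iff)
    then show "f = g" using PiE_ext[OF fg(1,2)] by auto
  qed
  moreover have "glue ` ({..<m} \<rightarrow>\<^sub>E C0) \<subseteq> base"
    using glue_in_base by (auto simp: PiE_iff)
  ultimately have "card ({..<m} \<rightarrow>\<^sub>E C0) \<le> card base"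
    using fin by (rule card_inj_on_le)
  then have "CARD('a) ^ (m * r * \<alpha>) \<le> card base"
    by (simp add: card_PiE C0_facts(6) power_mult [symmetric] mult_ac)
  moreover have "card base \<le> CARD('a) ^ (m * r * \<alpha>)"
    using le(2) finite_subset[OF T(1)] T(2) by (simp add: card_cartesian_product)
  ultimately show "card base = CARD('a) ^ (m * r * \<alpha>)" by simp
qed

section \<open>Linearity, dimension and local codes of the extended code\<close>

lemma extend_info: "i \<le> m * N \<Longrightarrow> extend W c (i, j) = c (i, j)"
  by (simp add: extend_def)

lemma subspace_extend: "fs.subspace (extend W ` base)"
  by (rule subspace_image[OF subspace_base])
    (auto simp: extend_def fscale_def fun_eq_iff algebra_simps sum.distrib sum_distrib_left)

lemma finite_extend: "finite (extend W ` base)"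
  using finite_base by simp

lemma dim_extend: "fs.dim (extend W ` base) = m * r * \<alpha>"
proof (rule dim_eqI[OF finite_extend subspace_extend])
  have "inj_on (extend W) base"
  proof (rule inj_onI)
    fix c c' assume c: "c \<in> base" "c' \<in> base" and eq: "extend W c = extend W c'"
    have "c (i, j) = c' (i, j)" for i j
      using extend_info[of i W c j] extend_info[of i W c' j] eq
        base_outside[OF c(1), of i j] base_outside[OF c(2), of i j]
      by (cases "i \<le> m * N") auto
    then show "c = c'" by (auto simp: fun_eq_iff)
  qed
  then show "card (extend W ` base) = CARD('a) ^ (m * r * \<alpha>)"
    using card_image card_base by metis
qed

lemma extend_word_space: "extend W ` base \<subseteq> word_space {1..n} \<alpha>"
  using mN by (auto simp: word_space_def extend_def base_def)

lemma puncture_extend: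
  assumes "a < m"
  shows "puncture (blk a) (extend W ` base) = place (a * N) ` C0"
proof -
  have "block N (a * N) (extend W c) = block N (a * N) c" for c
    using blk_bound[OF assms] by (auto simp: block_def extend_info fun_eq_iff)
  then have "block N (a * N) ` extend W ` base = block N (a * N) ` base"
    by (simp add: image_image)
  also have "\<dots> = C0"
  proof
    show "block N (a * N) ` base \<subseteq> C0" using assms by (auto simp: base_def)
    show "C0 \<subseteq> block N (a * N) ` base"
    proof
      fix c assume "c \<in> C0"
      \<comment> \<open>The word with \<open>c\<close> in every block is a preimage.\<close>
      then show "c \<in> block N (a * N) ` base"
        using block_glue[OF assms, of "\<lambda>_. c"] glue_in_base[of "\<lambda>_. c"] by (metis image_eqI)
    qed
  qed
  finally show ?thesis
    unfolding blk_def puncture_eq_place_block by simp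
qed

lemma msr_puncture_extend:
  "a < m \<Longrightarrow> msr_code (blk a) r d \<alpha> \<beta> (puncture (blk a) (extend W ` base))"
  using msr_code_place[OF C0 r] puncture_extend by (simp add: blk_def)

lemma local_code_extend:
  "a < m \<Longrightarrow> local_code {1..n} r (e + 1) (extend W ` base) (blk a)"
proof -
  assume a: "a < m"
  have "blk a \<subseteq> {1..n}" using blk_bound[OF a] mN by (auto simp: blk_def)
  then show ?thesis
    using msr_code_min_dist[OF msr_puncture_extend[OF a] r, of W] N card_blk
    by (simp add: local_code_def)
qed

text \<open>Supplies the information set through each position that independence of its thick column
  requires.\<close>

lemma ex_good:
  assumes "i \<in> {1..n}"
  shows "\<exists>T. i \<in> T \<and> good T"
proof -
  have "card ({i} \<inter> blk a) \<le> r" for a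
    using r card_mono[of "{i}" "{i} \<inter> blk a"] by simp
  then obtain T0 where T0: "T0 \<subseteq> {1..m * N}" "{i} \<inter> {1..m * N} \<subseteq> T0" "card T0 = m * r"
    "\<And>a. a < m \<Longrightarrow> card (T0 \<inter> blk a) = r"
    using ex_transversal_blk[of "{i}"] by auto
  have fin: "finite T0" using T0(1) finite_subset by blast
  \<comment> \<open>If \<open>i\<close> is a local position, it already lies in \<open>T0\<close>.
    For a parity position \<open>insert i T0\<close> has one element too many, and any element other
    than \<open>i\<close> may be dropped.\<close>
  have "\<exists>T. {i} \<subseteq> T \<and> T \<subseteq> insert i T0 \<and> card T = m * r"
    using T0(3) fin m r by (intro exists_subset_between) (auto simp: card_insert_if)
  then obtain T where T: "i \<in> T" "T \<subseteq> insert i T0" "card T = m * r" by auto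
  have "card (T \<inter> blk a) \<le> r" if a: "a < m" for a
  proof -
    have "blk a \<subseteq> {1..m * N}" using UN_blk a by blast
    then have "T \<inter> blk a \<subseteq> T0 \<inter> blk a" using T(2) T0(2) by blast
    then show ?thesis using card_mono[of "T0 \<inter> blk a"] fin T0(4)[OF a] by fastforce
  qed
  moreover have "T \<subseteq> {1..n}"
    using T(2) T0(1) assms mN by force
  ultimately have "good T" using T(3) by (simp add: good_def)
  then show ?thesis using T(1) by blast
qed

lemma vector_code_extend:
  assumes W: "determining W"
  shows "vector_code {1..n} \<alpha> (extend W ` base)"
proof (rule vector_code_if_determined)
  show "finite {1..n}" "\<alpha> \<ge> 1" "fs.subspace (extend W ` base)"
    "extend W ` base \<subseteq> word_space {1..n} \<alpha>"
    using C0_facts(2) subspace_extend extend_word_space by auto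
  fix i assume "i \<in> {1..n}"
  then obtain T where T: "i \<in> T" "good T" using ex_good by blast
  then show "\<exists>T. i \<in> T \<and> T \<subseteq> {1..n} \<and> card T * \<alpha> = fs.dim (extend W ` base) \<and>
      determines (T \<times> {..<\<alpha>}) (extend W ` base)"
    using determining_good[OF W T(2)] T by (intro exI[of _ T]) (simp add: good_def dim_extend)
qed

text \<open>A transversal of the blocks is a good set without parity positions, so the local symbols
  alone contain an information set.\<close>

lemma full_thick_rank_extend:
  assumes W: "determining W"
    and G: "generator_matrix (extend W ` base) G"
  shows "thick_rank (fs.dim (extend W ` base)) \<alpha> G (\<Union>a<m. blk a) = fs.dim (extend W ` base)"
proof -
  obtain T where T: "T \<subseteq> {1..m * N}" "card T = m * r" "\<And>a. a < m \<Longrightarrow> card (T \<inter> blk a) = r"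
    using ex_transversal_blk[of "{}"] by auto
  then have "good T" using mN by (auto simp: good_def)
  show ?thesis
  proof (rule thick_rank_eq_dim[OF G _ _ _ determining_good[OF W \<open>good T\<close>] subspace_extend])
    show "finite T" using T(1) finite_subset by blast
    show "card T * \<alpha> = fs.dim (extend W ` base)" using T(2) by (simp add: dim_extend)
    show "T \<subseteq> (\<Union>a<m. blk a)" using T(1) UN_blk by simp
  qed
qed

lemma msr_local_code_extend:
  assumes W: "determining W"
  shows "msr_local_code {1..n} m r (e + 1) d \<alpha> (extend W ` base)"
proof -
  \<comment> \<open>Local codes are indexed from 1, blocks from 0.\<close>
  let ?C = "extend W ` base" and ?S = "\<lambda>i. blk (i - 1)"
  obtain G where G: "generator_matrix ?C G"
    using generator_matrix_exists[OF finite_extend subspace_extend] by blast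
  have UN: "(\<Union>i\<in>{1..m}. ?S i) = (\<Union>a<m. blk a)"
    unfolding image_Suc_lessThan[symmetric] by simp
  have idx: "i - 1 < m" if "i \<in> {1..m}" for i using that by auto
  have loc: "\<forall>i\<in>{1..m}. local_code {1..n} r (e + 1) ?C (?S i)"
    using local_code_extend idx by blast
  have rank: "thick_rank (fs.dim ?C) \<alpha> G (\<Union>i\<in>{1..m}. ?S i) = fs.dim ?C"
    unfolding UN using full_thick_rank_extend[OF W G] .
  have "information_locality {1..n} \<alpha> r (e + 1) ?C"
    unfolding information_locality_def
    by (rule exI[of _ "{1..m}"], rule exI[of _ ?S], intro conjI loc exI[of _ G] G rank)
  moreover have "\<forall>i\<in>{1..m}. local_code {1..n} r (e + 1) ?C (?S i) \<and>
      card (?S i) = r + (e + 1) - 1 \<and> (\<exists>\<beta>. msr_code (?S i) r d \<alpha> \<beta> (puncture (?S i) ?C))"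
  proof
    fix i assume i: "i \<in> {1..m}"
    show "local_code {1..n} r (e + 1) ?C (?S i) \<and> card (?S i) = r + (e + 1) - 1 \<and>
        (\<exists>\<beta>. msr_code (?S i) r d \<alpha> \<beta> (puncture (?S i) ?C))"
      using bspec[OF loc i] card_blk N msr_puncture_extend[OF idx[OF i]] by auto
  qed
  ultimately show ?thesis
    unfolding msr_local_code_def
    using vector_code_extend[OF W]
    by (intro conjI exI[of _ ?S] exI[of _ G] G rank) auto
qed

section \<open>The minimum distance\<close>

text \<open>By counting, \<open>r - 1\<close> symbols do not determine \<open>C0\<close>. A nonzero
  word of \<open>C0\<close> vanishing on the first \<open>r - 1\<close> symbols, put into the last
  block after zero blocks, vanishes on an initial segment of positions.\<close>

lemma low_weight_word:
  obtains c where "c \<in> extend W ` base" "c \<noteq> 0" "weight c \<le> n - ((m - 1) * N + (r - 1))"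
proof -
  have "\<not> determines ({1..r - 1} \<times> {..<\<alpha>}) C0"
  proof
    assume "determines ({1..r - 1} \<times> {..<\<alpha>}) C0"
    from determines_card_le(2)[OF _ C0_facts(3) this]
    have "CARD('a) ^ (r * \<alpha>) \<le> CARD('a) ^ ((r - 1) * \<alpha>)"
      by (simp add: C0_facts(6) card_cartesian_product)
    then have "r * \<alpha> \<le> (r - 1) * \<alpha>"
      using CARD_gt_1[where 'a='a] by (simp add: power_increasing_iff)
    then show False using r C0_facts(2) by (auto simp: mult_le_cancel2)
  qed
  then obtain c0 where c0: "c0 \<in> C0" "\<forall>x\<in>{1..r - 1} \<times> {..<\<alpha>}. c0 x = 0" "c0 \<noteq> 0"
    by (auto simp: determines_def)
  define f where "f a = (if a = m - 1 then c0 else 0)" for a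
  have f: "f a \<in> C0" for a using c0 fs.subspace_0[OF C0_facts(3)] by (simp add: f_def)
  let ?c = "extend W (glue f)" and ?s = "(m - 1) * N + (r - 1)"
  have mpos: "m - 1 < m" using m by simp
  have bound: "?s < m * N"
    using blk_bound[OF mpos] r N by simp
  have glue0: "glue f (i, j) = 0" if i: "i \<le> ?s" for i j
  proof (cases "i = 0 \<or> \<not> j < \<alpha> \<or> i > m * N")
    case True
    then show ?thesis using base_outside[OF glue_in_base[OF f], of i j] by auto
  next
    case False
    have "(i - 1) mod N + 1 \<in> {1..r - 1}" if eq: "(i - 1) div N = m - 1"
    proof -
      have "i - 1 = (m - 1) * N + (i - 1) mod N" using eq div_mult_mod_eq[of "i - 1" N] by simp
      then show ?thesis using i False by auto
    qed
    then show ?thesis using c0(2) False by (auto simp: glue_def f_def)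
  qed
  have c: "?c (i, j) = 0" if "i \<le> ?s \<or> i > n" for i j
  proof (cases "i \<le> ?s")
    case True
    then show ?thesis using glue0[OF True] bound extend_info[of i] by simp
  next
    case False
    then show ?thesis
      using that subsetD[OF extend_word_space imageI[OF glue_in_base[OF f]], of W]
      by (simp add: word_space_def)
  qed
  have "{i. curry ?c i \<noteq> 0} \<subseteq> {1..n} - {1..?s}"
  proof
    fix i assume "i \<in> {i. curry ?c i \<noteq> 0}"
    then have "\<not> (i \<le> ?s \<or> i > n)" using c[of i] by (auto simp: curry_eq_0_iff)
    then show "i \<in> {1..n} - {1..?s}" by auto
  qed
  then have "weight ?c \<le> card ({1..n} - {1..?s})"
    unfolding weight_def by (rule card_mono[rotated]) simp
  also have "\<dots> = n - ?s"
    using bound mN by (subst card_Diff_subset) auto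
  finally have "weight ?c \<le> n - ?s" .
  moreover have "?c \<noteq> 0"
  proof
    assume z: "?c = 0"
    have "glue f (i, j) = 0" for i j
      using extend_info[of i W "glue f" j] base_outside[OF glue_in_base[OF f], of i j] z
      by (cases "i \<le> m * N") auto
    then have "glue f = 0" by (auto simp: fun_eq_iff)
    then have "block N ((m - 1) * N) (glue f) = 0" by (simp add: block_0)
    then show False using block_glue[where f = f, OF mpos f] c0(3) by (simp add: f_def)
  qed
  ultimately show thesis
    by (intro that[of ?c] imageI glue_in_base f)
qed

lemma min_dist_extend:
  assumes W: "determining W"
  shows "min_dist (extend W ` base) = n - ((m - 1) * N + (r - 1))"
proof (rule antisym)
  let ?C = "extend W ` base" and ?s = "(m - 1) * N + (r - 1)"
  obtain c where c: "c \<in> ?C" "c \<noteq> 0" "weight c \<le> n - ?s"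
    using low_weight_word by blast
  have "min_dist ?C \<le> weight c"
    unfolding min_dist_def using c by (intro cINF_lower) auto
  then show "min_dist ?C \<le> n - ?s" using c(3) by simp
  show "n - ?s \<le> min_dist ?C"
    unfolding min_dist_def
  proof (rule cINF_greatest)
    show "?C - {0} \<noteq> {}" using c by blast
    fix c assume c: "c \<in> ?C - {0}"
    let ?Z = "{i \<in> {1..n}. curry c i = 0}"
    have "c \<in> word_space {1..n} \<alpha>"
      using c extend_word_space by blast
    then have weight: "weight c = n - card ?Z"
      using weight_eq_diff[of "{1..n}"] by simp
    have "card ?Z \<le> ?s"
    proof (rule ccontr)
      assume "\<not> card ?Z \<le> ?s"
      \<comment> \<open>One zero more than \<open>?s\<close> is exactly the threshold from which a
        good set fits inside the zero positions.\<close>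
      moreover have "m * r + (m - 1) * e = Suc ?s"
        using m r N by (cases m) (auto simp: algebra_simps)
      ultimately have "card {..<m} * r + (card {..<m} - 1) * e \<le> card ?Z" by simp
      from ex_subset_few_per_block[OF _ disjoint_blk _ _ this]
      obtain T where T: "T \<subseteq> ?Z" "card T = m * r" "\<forall>a<m. card (T \<inter> blk a) \<le> r"
        using finite_blk card_blk N by auto
      then have "good T" by (auto simp: good_def)
      then show False
        using determining_good[OF W, of T] c T(1) by (auto simp: determines_def curry_eq_0_iff)
    qed
    then show "n - ?s \<le> weight c" using weight by simp
  qed
qed

end

section \<open>Existence of the code and evaluation of the distance formula\<close>

theorem mainTheorem10:
  fixes r \<delta> m n n\<^sub>L d \<alpha> \<beta> :: nat
  assumes "r \<ge> 1" and "\<delta> \<ge> 3" and "m \<ge> 2"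
    and "n\<^sub>L = r + \<delta> - 1"
    and "n \<ge> m * n\<^sub>L"
    and "CARD('a::{field,finite}) > n choose (m * r)"
    and "\<exists>C\<^sub>0 :: 'a word set. msr_code {1..n\<^sub>L} r d \<alpha> \<beta> C\<^sub>0"
  shows "\<exists>(C :: 'a word set) K.
           msr_local_code {1..n} m r \<delta> d \<alpha> C \<and>
           fs.dim C = K \<and> K = m * r * \<alpha> \<and>
           real (min_dist C) =
             real n - real K / real \<alpha> + 1
             - (real K / (real r * real \<alpha>) - 1) * (real \<delta> - 1)"
proof -
  obtain C\<^sub>0 :: "'a word set" where C\<^sub>0: "msr_code {1..n\<^sub>L} r d \<alpha> \<beta> C\<^sub>0"
    using assms(7) by blast
  interpret msr_blocks C\<^sub>0 n\<^sub>L r "\<delta> - 1" m n d \<alpha> \<beta>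
    using assms C\<^sub>0 by unfold_locales auto
  obtain W where W: "determining W"
    using ex_good_functionals[OF assms(6)] by blast
  let ?s = "(m - 1) * n\<^sub>L + (r - 1)"
  \<comment> \<open>Ensures that the truncated difference \<open>n - ?s\<close> agrees with the real
    one.\<close>
  have "?s \<le> m * n\<^sub>L"
    using assms by (cases m) auto
  then have "?s \<le> n" using assms(5) by linarith
  then have "real (min_dist (extend W ` base)) = real n - real ?s"
    by (simp add: min_dist_extend[OF W] of_nat_diff)
  also have "real ?s = (real m - 1) * (real r + real \<delta> - 1) + (real r - 1)"
    using assms(1-4) by (simp add: of_nat_diff)
  also have "real n - \<dots> = real n - real m * real r + 1 - (real m - 1) * (real \<delta> - 1)"
    by (simp add: algebra_simps)
  \<comment> \<open>With \<open>K = m * r * \<alpha>\<close> the quotients are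
    \<open>K / \<alpha> = m * r\<close> and \<open>K / (r * \<alpha>) = m\<close>.\<close>
  also have "\<dots> = real n - real (m * r * \<alpha>) / real \<alpha> + 1
      - (real (m * r * \<alpha>) / (real r * real \<alpha>) - 1) * (real \<delta> - 1)"
    using assms(1) C0_facts(2) by simp
  finally show ?thesis
    using msr_local_code_extend[OF W] dim_extend[of W] assms(2)
    by (intro exI[of _ "extend W ` base"] exI[of _ "m * r * \<alpha>"]) simp
qed

end
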